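(* Let $\alpha,\beta>-1$, $0<k<\beta+1$, $\ell\in\mathbb N$. The differential operators $$D=u(1-u)\frac{d^2}{du^2}+(C-uU)\frac{d}{du}-V$$ and $$E=(1-u)(Q_0+uQ_1)\frac{d^2}{du^2}+(P_0+uP_1)\frac{d}{du}-(\alpha+2\ell+3k)V,$$ with the matrices $C,U,V,Q_0,Q_1,P_0,P_1$ given in the context, commute: $DE=ED$.
   Context: Matrices are $(\ell+1)\times(\ell+1)$ with rows and columns indexed by $0,\dots,\ell$; $E_{ij}$ is the matrix with $(i,j)$ entry $1$ and all other entries $0$; terms with an index outside $\{0,\dots,\ell\}$ (whose coefficients vanish) are zero. $\mathbb N=\{1,2,\dots\}$. Differential operators have coefficients multiplying on the left, and products are compositions. $$C=\sum_{i=0}^\ell(\beta+1+2i)E_{ii}+\sum_{i=1}^\ell iE_{i,i-1},\qquad U=\sum_{i=0}^\ell(\alpha+\beta+\ell+i+2)E_{ii},$$ $$V=\sum_{i=0}^\ell i(\alpha+\beta-k+1+i)E_{ii}-\sum_{i=0}^{\ell-1}(\ell-i)(\beta-k+1+i)E_{i,i+1},$$ $$Q_0=\sum_{i=0}^\ell3iE_{i,i-1},\qquad Q_1=\sum_{i=0}^\ell(\alpha-\ell+3i)E_{ii},$$ $$P_0=\sum_{i=0}^\ell\big((\alpha+2\ell)(\beta+1+2i)-3k(\ell-i)-3i(\beta-k+i)\big)E_{ii}-\sum_{i=0}^\ell i(3i+3\beta-3k+3+\ell+2\alpha)E_{i,i-1},$$ $$P_1=-\sum_{i=0}^\ell(\alpha-\ell+3i)(\alpha+\beta+\ell+i+2)E_{ii}+\sum_{i=0}^\ell3(\beta-k+1+i)(\ell-i)E_{i,i+1}.$$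 *)

theory Defs
  imports "HOL-Analysis.Derivative" "Jordan_Normal_Form.Matrix"
begin

section \<open>Smooth matrix-valued functions of a real variable\<close>

text \<open>Functions have values in the complex matrices with \<open>n\<close> rows and \<open>m\<close> columns and are
  differentiated entrywise; \<open>m = 1\<close> gives vector-valued and \<open>m = n\<close> square-matrix-valued functions.\<close>

definition smooth_on :: "real set \<Rightarrow> (real \<Rightarrow> complex) \<Rightarrow> bool" where
  "smooth_on S f \<longleftrightarrow>
     (\<forall>p. \<forall>u\<in>S. ((\<lambda>g t. vector_derivative g (at t)) ^^ p) f differentiable (at u))"

definition smooth_mat_fun :: "real set \<Rightarrow> nat \<Rightarrow> nat \<Rightarrow> (real \<Rightarrow> complex mat) set" where
  "smooth_mat_fun S n m =
     {F. (\<forall>u\<in>S. F u \<in> carrier_mat n m) \<and>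
         (\<forall>i<n. \<forall>j<m. smooth_on S (\<lambda>u. F u $$ (i, j)))}"

definition mat_deriv :: "(real \<Rightarrow> complex mat) \<Rightarrow> real \<Rightarrow> complex mat" where
  "mat_deriv F u =
     mat (dim_row (F u)) (dim_col (F u))
       (\<lambda>(i, j). vector_derivative (\<lambda>t. F t $$ (i, j)) (at u))"

section \<open>Second-order matrix differential operators\<close>

abbreviation cmat :: "real mat \<Rightarrow> complex mat" where
  "cmat \<equiv> map_mat complex_of_real"

text \<open>The operator \<open>A\<^sub>2(u) d\<^sup>2/du\<^sup>2 + A\<^sub>1(u) d/du + A\<^sub>0(u)\<close>, coefficients multiplying on the left.
  Products of operators are compositions of these maps.\<close>

definition diff_op2 ::
  "(real \<Rightarrow> real mat) \<Rightarrow> (real \<Rightarrow> real mat) \<Rightarrow> (real \<Rightarrow> real mat) \<Rightarrow>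
   (real \<Rightarrow> complex mat) \<Rightarrow> (real \<Rightarrow> complex mat)" where
  "diff_op2 A2 A1 A0 F =
     (\<lambda>u. cmat (A2 u) * mat_deriv (mat_deriv F) u + cmat (A1 u) * mat_deriv F u + cmat (A0 u) * F u)"

section \<open>The coefficient matrices\<close>

text \<open>\<open>Eunit i j r c\<close> is the \<open>(r, c)\<close> entry of the matrix unit \<open>E\<^sub>i\<^sub>j\<close>. All matrices below have rows
  and columns indexed by \<open>0, \<dots>, l\<close>. Truncated subtraction is harmless: \<open>i - 1\<close> is used only for \<open>i \<ge> 1\<close>
  or with a coefficient vanishing at \<open>i = 0\<close>; all other subtractions are in the reals.\<close>

definition Eunit :: "nat \<Rightarrow> nat \<Rightarrow> nat \<Rightarrow> nat \<Rightarrow> real" where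
  "Eunit i j r c = (if r = i \<and> c = j then 1 else 0)"

definition C_mat :: "real \<Rightarrow> nat \<Rightarrow> real mat" where
  "C_mat \<beta> l = mat (l + 1) (l + 1) (\<lambda>(r, c).
     (\<Sum>i = 0..l. (\<beta> + 1 + 2 * real i) * Eunit i i r c)
   + (\<Sum>i = 1..l. real i * Eunit i (i - 1) r c))"

definition U_mat :: "real \<Rightarrow> real \<Rightarrow> nat \<Rightarrow> real mat" where
  "U_mat \<alpha> \<beta> l = mat (l + 1) (l + 1) (\<lambda>(r, c).
     \<Sum>i = 0..l. (\<alpha> + \<beta> + real l + real i + 2) * Eunit i i r c)"

definition V_mat :: "real \<Rightarrow> real \<Rightarrow> real \<Rightarrow> nat \<Rightarrow> real mat" where
  "V_mat \<alpha> \<beta> k l = mat (l + 1) (l + 1) (\<lambda>(r, c).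
     (\<Sum>i = 0..l. real i * (\<alpha> + \<beta> - k + 1 + real i) * Eunit i i r c)
   - (\<Sum>i = 0..<l. (real l - real i) * (\<beta> - k + 1 + real i) * Eunit i (i + 1) r c))"

definition Q0_mat :: "nat \<Rightarrow> real mat" where
  "Q0_mat l = mat (l + 1) (l + 1) (\<lambda>(r, c).
     \<Sum>i = 0..l. 3 * real i * Eunit i (i - 1) r c)"

definition Q1_mat :: "real \<Rightarrow> nat \<Rightarrow> real mat" where
  "Q1_mat \<alpha> l = mat (l + 1) (l + 1) (\<lambda>(r, c).
     \<Sum>i = 0..l. (\<alpha> - real l + 3 * real i) * Eunit i i r c)"

definition P0_mat :: "real \<Rightarrow> real \<Rightarrow> real \<Rightarrow> nat \<Rightarrow> real mat" where
  "P0_mat \<alpha> \<beta> k l = mat (l + 1) (l + 1) (\<lambda>(r, c).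
     (\<Sum>i = 0..l. ((\<alpha> + 2 * real l) * (\<beta> + 1 + 2 * real i) - 3 * k * (real l - real i)
                  - 3 * real i * (\<beta> - k + real i)) * Eunit i i r c)
   - (\<Sum>i = 0..l. real i * (3 * real i + 3 * \<beta> - 3 * k + 3 + real l + 2 * \<alpha>)
                  * Eunit i (i - 1) r c))"

definition P1_mat :: "real \<Rightarrow> real \<Rightarrow> real \<Rightarrow> nat \<Rightarrow> real mat" where
  "P1_mat \<alpha> \<beta> k l = mat (l + 1) (l + 1) (\<lambda>(r, c).
   - (\<Sum>i = 0..l. (\<alpha> - real l + 3 * real i) * (\<alpha> + \<beta> + real l + real i + 2) * Eunit i i r c)
   + (\<Sum>i = 0..l. 3 * (\<beta> - k + 1 + real i) * (real l - real i) * Eunit i (i + 1) r c))"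

section \<open>The two operators\<close>

definition D_op :: "real \<Rightarrow> real \<Rightarrow> real \<Rightarrow> nat \<Rightarrow>
    (real \<Rightarrow> complex mat) \<Rightarrow> (real \<Rightarrow> complex mat)" where
  "D_op \<alpha> \<beta> k l = diff_op2
     (\<lambda>u. (u * (1 - u)) \<cdot>\<^sub>m 1\<^sub>m (l + 1))
     (\<lambda>u. C_mat \<beta> l - u \<cdot>\<^sub>m U_mat \<alpha> \<beta> l)
     (\<lambda>u. - V_mat \<alpha> \<beta> k l)"

definition E_op :: "real \<Rightarrow> real \<Rightarrow> real \<Rightarrow> nat \<Rightarrow>
    (real \<Rightarrow> complex mat) \<Rightarrow> (real \<Rightarrow> complex mat)" where
  "E_op \<alpha> \<beta> k l = diff_op2
     (\<lambda>u. (1 - u) \<cdot>\<^sub>m (Q0_mat l + u \<cdot>\<^sub>m Q1_mat \<alpha> l))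
     (\<lambda>u. P0_mat \<alpha> \<beta> k l + u \<cdot>\<^sub>m P1_mat \<alpha> \<beta> k l)
     (\<lambda>u. - ((\<alpha> + 2 * real l + 3 * k) \<cdot>\<^sub>m V_mat \<alpha> \<beta> k l))"

end

theory Submission
  imports Defs
begin

text \<open>
  The operators are compared row by row. Every coefficient matrix is tridiagonal, so row \<open>i\<close> of \<open>D F\<close>
  or \<open>E F\<close> involves only the rows \<open>i - 1\<close>, \<open>i\<close>, \<open>i + 1\<close> of \<open>F\<close> and their first two derivatives,
  with coefficients that are polynomials in \<open>\<alpha>\<close>, \<open>\<beta>\<close>, \<open>k\<close>, \<open>l\<close>, \<open>i\<close> and \<open>u\<close>. The coefficients leading out
  of the range \<open>0, \<dots>, l\<close> contain the factor \<open>i\<close> or \<open>l - i\<close> and vanish at the boundary. Hence the rows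
  may be indexed by all integers, and commutation becomes a family of polynomial identities in which
  \<open>i\<close> and \<open>l\<close> are indeterminates.

  The computation becomes short after one reduction: the zero-order term of \<open>E\<close> is \<open>\<alpha> + 2 l + 3 k\<close> times
  that of \<open>D\<close>, and \<open>E = (\<alpha> + 2 l + 3 k) D + 3 R\<close> where
  \[ R = (1 - u) (N - u K) \partial^2 - \big((N - u K) U + T\big) \partial + u W \partial , \]
  \[ N = \sum i E_{i,i-1}, \quad K = \sum (l + k - i) E_{ii}, \quad
     W = \sum (l - i)(\beta - k + 1 + i) E_{i,i+1}, \quad
     T = \sum (i (i + \beta) + k (l + \beta + 1)) E_{ii} . \]
  It remains to see that \<open>D\<close> and \<open>R\<close> commute (\<open>D_jet_R_jet_commute\<close>). In \<open>D R - R D\<close> the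
  coefficient of each derivative of each row is a polynomial. Those of highest order and those of the outermost
  shifts mostly cancel at sight, because the leading coefficient \<open>u (1 - u)\<close> of \<open>D\<close> is scalar and \<open>N\<close> and \<open>W\<close> occur
  in both operators; the nine that remain vanish as polynomials.

  To compose operators without differentiating products again and again, a smooth column is represented by its
  jet, the family of all derivatives of all its entries, and \<open>D\<close> and \<open>R\<close> are prolonged to jets
  by the Leibniz rule. The prolongation of an operator, applied to the jet of a column, is the jet of its image
  (\<open>column_jet_D_op\<close>, \<open>column_jet_E_op\<close>), so the composition of operators becomes
  the composition of prolongations, which is algebra at a fixed point \<open>u\<close>.
\<close>

section \<open>The operators on jets\<close>

text \<open>For a jet \<open>y\<close> at the point \<open>u\<close>, \<open>y i p\<close> stands for the \<open>p\<close>-th derivative of row \<open>i\<close>. The value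
  below is the \<open>p\<close>-th derivative of row \<open>i\<close> of \<open>D y\<close>; by Leibniz, the coefficients being of degree at most two
  in \<open>u\<close>, the terms with the factors \<open>of_nat p\<close> and \<open>of_nat p * (of_nat p - 1)\<close> come from their first and second
  derivatives.\<close>

definition D_jet :: "complex \<Rightarrow> complex \<Rightarrow> complex \<Rightarrow> complex \<Rightarrow> complex \<Rightarrow>
    (int \<Rightarrow> nat \<Rightarrow> complex) \<Rightarrow> int \<Rightarrow> nat \<Rightarrow> complex" where
  "D_jet a b k L u y i p =
     u * (1 - u) * y i (p + 2)
   + (b + 1 + 2 * of_int i - u * (a + b + L + of_int i + 2) + of_nat p * (1 - 2 * u)) * y i (p + 1)
   + of_int i * y (i - 1) (p + 1)
   - (of_int i * (a + b - k + 1 + of_int i) + of_nat p * (a + b + L + of_int i + 2)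
      + of_nat p * (of_nat p - 1)) * y i p
   + (L - of_int i) * (b - k + 1 + of_int i) * y (i + 1) p"

text \<open>The same for the operator \<open>R = (E - (\<alpha> + 2 l + 3 k) D) / 3\<close>, which has no zero-order term.\<close>

definition R_jet :: "complex \<Rightarrow> complex \<Rightarrow> complex \<Rightarrow> complex \<Rightarrow> complex \<Rightarrow>
    (int \<Rightarrow> nat \<Rightarrow> complex) \<Rightarrow> int \<Rightarrow> nat \<Rightarrow> complex" where
  "R_jet a b k L u y i p =
     of_int i * ((1 - u) * y (i - 1) (p + 2) - of_nat p * y (i - 1) (p + 1))
   - (L + k - of_int i) * (u * (1 - u) * y i (p + 2) + of_nat p * (1 - 2 * u) * y i (p + 1)
      - of_nat p * (of_nat p - 1) * y i p)
   - of_int i * (a + b + L + of_int i + 1) * y (i - 1) (p + 1)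
   - (of_int i * (of_int i + b) + k * (L + b + 1)) * y i (p + 1)
   + (L + k - of_int i) * (a + b + L + of_int i + 2) * (u * y i (p + 1) + of_nat p * y i p)
   + (L - of_int i) * (b - k + 1 + of_int i) * (u * y (i + 1) (p + 1) + of_nat p * y (i + 1) p)"

definition E_jet :: "complex \<Rightarrow> complex \<Rightarrow> complex \<Rightarrow> complex \<Rightarrow> complex \<Rightarrow>
    (int \<Rightarrow> nat \<Rightarrow> complex) \<Rightarrow> int \<Rightarrow> nat \<Rightarrow> complex" where
  "E_jet a b k L u y i p = (a + 2 * L + 3 * k) * D_jet a b k L u y i p + 3 * R_jet a b k L u y i p"

text \<open>The heart of the matter. Both sides are linear in \<open>y\<close>; the nine facts named \<open>c1\<close> to \<open>c9\<close> say that
  the coefficient of one particular \<open>y n q\<close> in the commutator vanishes, and all other coefficients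
  vanish by commutativity of multiplication alone.\<close>

lemma D_jet_R_jet_commute:
  "D_jet a b k L u (R_jet a b k L u y) i 0 = R_jet a b k L u (D_jet a b k L u y) i 0"
proof -
  \<comment> \<open>The coefficients of the prolonged operators are functions of the row \<open>j\<close> and the order \<open>p\<close>; kept folded,
    they make the expansion of the two composites a small computation.\<close>
  define x :: complex where "x = of_int i"
  define A where "A = u * (1 - u)"
  define K where "K j = L + k - j" for j
  define W where "W j = (L - j) * (b - k + 1 + j)" for j
  define B where "B j p = b + 1 + 2 * j - u * (a + b + L + j + 2) + p * (1 - 2 * u)" for j p
  define V where "V j p = j * (a + b - k + 1 + j) + p * (a + b + L + j + 2) + p * (p - 1)" for j p
  define M where "M j p = j * (a + b + L + j + 1 + p)" for j p
  define G where "G j p = K j * ((a + b + L + j + 2) * u - p * (1 - 2 * u))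
    - (j * (j + b) + k * (L + b + 1))" for j p
  define H where "H j p = K j * p * (p + a + b + L + j + 1)" for j p
  note defs = A_def K_def W_def B_def V_def M_def G_def H_def
  have D: "D_jet a b k L u z n p = A * z n (p + 2) + B (of_int n) (of_nat p) * z n (p + 1)
      + of_int n * z (n - 1) (p + 1) - V (of_int n) (of_nat p) * z n p
      + W (of_int n) * z (n + 1) p" for z n p
    unfolding D_jet_def defs by simp
  have R: "R_jet a b k L u z n p = of_int n * (1 - u) * z (n - 1) (p + 2)
      - M (of_int n) (of_nat p) * z (n - 1) (p + 1)
      - K (of_int n) * A * z n (p + 2) + G (of_int n) (of_nat p) * z n (p + 1)
      + H (of_int n) (of_nat p) * z n p
      + W (of_int n) * u * z (n + 1) (p + 1) + W (of_int n) * of_nat p * z (n + 1) p" for z n p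
    unfolding R_jet_def defs by (simp add: algebra_simps)
  have H0: "H j 0 = 0" for j
    by (simp add: H_def)
  \<comment> \<open>The method is qualified since abstract algebra has another one of the same short name.\<close>
  have c1: "x * M (x - 1) 1
      = M x 0 * (x - 1)" (is "?l1 = ?r1")
    unfolding defs by Groebner_Basis.algebra
  have c2: "- A * M x 2 + B x 0 * x * (1 - u) - x * K (x - 1) * A
      = x * (1 - u) * B (x - 1) 2 - M x 0 * A - K x * A * x" (is "?l2 = ?r2")
    unfolding defs by Groebner_Basis.algebra
  have c3: "- B x 0 * M x 1 + x * G (x - 1) 1 - V x 0 * x * (1 - u)
      = - x * (1 - u) * V (x - 1) 2 - M x 0 * B (x - 1) 1 + G x 0 * x" (is "?l3 = ?r3")
    unfolding defs by Groebner_Basis.algebra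
  have c4: "x * H (x - 1) 1 + V x 0 * M x 0
      = M x 0 * V (x - 1) 1" (is "?l4 = ?r4")
    unfolding defs by Groebner_Basis.algebra
  have c5: "A * G x 2 - B x 0 * K x * A
      = - K x * A * B x 2 + G x 0 * A" (is "?l5 = ?r5")
    unfolding defs by Groebner_Basis.algebra
  have c6: "A * H x 2 + B x 0 * G x 1 + x * W (x - 1) * u + V x 0 * K x * A + W x * (x + 1) * (1 - u)
      = x * (1 - u) * W (x - 1) + K x * A * V x 2 + G x 0 * B x 1 + W x * u * (x + 1)" (is "?l6 = ?r6")
    unfolding defs by Groebner_Basis.algebra
  have c7: "B x 0 * H x 1 + x * W (x - 1) - V x 0 * G x 0 - W x * M (x + 1) 0
      = - M x 0 * W (x - 1) - G x 0 * V x 1" (is "?l7 = ?r7")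
    unfolding defs by Groebner_Basis.algebra
  have c8: "2 * A * W x + B x 0 * W x * u - W x * K (x + 1) * A
      = - K x * A * W x + W x * u * B (x + 1) 1" (is "?l8 = ?r8")
    unfolding defs by Groebner_Basis.algebra
  have c9: "B x 0 * W x - V x 0 * W x * u + W x * G (x + 1) 0
      = G x 0 * W x - W x * u * V (x + 1) 1" (is "?l9 = ?r9")
    unfolding defs by Groebner_Basis.algebra
  have index: "n - 1 - 1 = n - (2::int)" "n + 1 + 1 = n + (2::int)" "n - 1 + 1 = n" "n + 1 - 1 = n"
      "(0::nat) + 1 = 1" "(0::nat) + 2 = 2" "(1::nat) + 1 = 2" "(1::nat) + 2 = 3" "(2::nat) + 1 = 3"
      "(2::nat) + 2 = 4" for n
    by auto
  have "D_jet a b k L u (R_jet a b k L u y) i 0 - R_jet a b k L u (D_jet a b k L u y) i 0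
      = 0 - (?l1 - ?r1) * y (i - 2) 2
        + (?l2 - ?r2) * y (i - 1) 3 + (?l3 - ?r3) * y (i - 1) 2 + (?l4 - ?r4) * y (i - 1) 1
        + (?l5 - ?r5) * y i 3 + (?l6 - ?r6) * y i 2 + (?l7 - ?r7) * y i 1
        + (?l8 - ?r8) * y (i + 1) 2 + (?l9 - ?r9) * y (i + 1) 1"
    unfolding D R
    apply (simp only: index H0 x_def [symmetric] of_int_add of_int_diff of_int_1
      of_nat_0 of_nat_1 of_nat_numeral)
    apply (simp only: mult_zero_left mult_1_right mult_zero_right ring_distribs mult_ac)
    by Groebner_Basis.algebra
  also have "\<dots> = 0"
    by (simp only: c1 c2 c3 c4 c5 c6 c7 c8 c9) simp
  finally show ?thesis
    by simp
qed

lemma D_jet_linear: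
  "D_jet a b k L u (\<lambda>n p. c * y n p + d * z n p) i p = c * D_jet a b k L u y i p + d * D_jet a b k L u z i p"
  unfolding D_jet_def by (simp add: ring_distribs mult_ac)

lemma D_jet_E_jet_commute:
  "D_jet a b k L u (E_jet a b k L u y) i 0 = E_jet a b k L u (D_jet a b k L u y) i 0"
proof -
  let ?c = "a + 2 * L + 3 * k"
  have "E_jet a b k L u y = (\<lambda>n p. ?c * D_jet a b k L u y n p + 3 * R_jet a b k L u y n p)"
    by (intro ext) (rule E_jet_def)
  then have "D_jet a b k L u (E_jet a b k L u y) i 0
      = ?c * D_jet a b k L u (D_jet a b k L u y) i 0 + 3 * D_jet a b k L u (R_jet a b k L u y) i 0"
    by (simp only: D_jet_linear)
  then show ?thesis
    by (simp only: D_jet_R_jet_commute E_jet_def)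
qed

section \<open>Jets of functions\<close>

definition jet_on :: "real set \<Rightarrow> (real \<Rightarrow> int \<Rightarrow> nat \<Rightarrow> complex) \<Rightarrow> bool" where
  "jet_on S y \<longleftrightarrow>
     (\<forall>n p. \<forall>t\<in>S. ((\<lambda>s. y s n p) has_vector_derivative y t n (Suc p)) (at t))"

text \<open>This is what singles out the dependence of the coefficients on \<open>p\<close>: differentiating the entry of order
  \<open>p\<close>, the point \<open>u\<close> being a function of \<open>t\<close> as well, gives the entry of order \<open>Suc p\<close>.\<close>

lemma jet_on_D_jet:
  assumes "jet_on S y"
  shows "jet_on S (\<lambda>t. D_jet a b k L (of_real t) (y t))"
  unfolding jet_on_def
proof (intro allI ballI)
  fix n p t assume t: "t \<in> S"
  have y [derivative_intros]:
    "((\<lambda>s. y s m q) has_vector_derivative y t m (Suc q)) (at t)" for m q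
    using assms t by (simp add: jet_on_def)
  have u [derivative_intros]: "(complex_of_real has_vector_derivative 1) (at t)"
    using has_vector_derivative_of_real[OF DERIV_ident] by simp
  show "((\<lambda>s. D_jet a b k L (of_real s) (y s) n p) has_vector_derivative
         D_jet a b k L (of_real t) (y t) n (Suc p)) (at t)"
    unfolding D_jet_def
    by (rule derivative_eq_intros refl)+ (simp add: algebra_simps)
qed

lemma jet_on_R_jet:
  assumes "jet_on S y"
  shows "jet_on S (\<lambda>t. R_jet a b k L (of_real t) (y t))"
  unfolding jet_on_def
proof (intro allI ballI)
  fix n p t assume t: "t \<in> S"
  have y [derivative_intros]:
    "((\<lambda>s. y s m q) has_vector_derivative y t m (Suc q)) (at t)" for m q
    using assms t by (simp add: jet_on_def)
  have u [derivative_intros]: "(complex_of_real has_vector_derivative 1) (at t)"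
    using has_vector_derivative_of_real[OF DERIV_ident] by simp
  show "((\<lambda>s. R_jet a b k L (of_real s) (y s) n p) has_vector_derivative
         R_jet a b k L (of_real t) (y t) n (Suc p)) (at t)"
    unfolding R_jet_def
    by (rule derivative_eq_intros refl)+ (simp add: algebra_simps)
qed

lemma jet_on_E_jet:
  assumes "jet_on S y"
  shows "jet_on S (\<lambda>t. E_jet a b k L (of_real t) (y t))"
  using jet_on_D_jet[OF assms, of a b k L] jet_on_R_jet[OF assms, of a b k L]
  unfolding jet_on_def E_jet_def
  by (auto intro!: has_vector_derivative_add has_vector_derivative_mult_right)

text \<open>\<open>y\<close> is a jet whose rows \<open>0, \<dots>, l\<close> belong to column \<open>j\<close> of \<open>F\<close>. The remaining rows are left open
  on purpose: the images of such a jet under \<open>D_jet\<close> and \<open>E_jet\<close> need not vanish there, and nothing that happens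
  there can reach the rows \<open>0, \<dots>, l\<close>.\<close>

definition column_jet ::
  "real set \<Rightarrow> nat \<Rightarrow> nat \<Rightarrow> nat \<Rightarrow> (real \<Rightarrow> complex mat) \<Rightarrow> (real \<Rightarrow> int \<Rightarrow> nat \<Rightarrow> complex) \<Rightarrow> bool" where
  "column_jet S l m j F y \<longleftrightarrow> jet_on S y \<and>
     (\<forall>t\<in>S. F t \<in> carrier_mat (l + 1) m \<and> (\<forall>i\<le>l. F t $$ (i, j) = y t (int i) 0))"

lemma column_jet_exists:
  assumes F: "F \<in> smooth_mat_fun S (l + 1) m" and j: "j < m"
  shows "\<exists>y. column_jet S l m j F y"
proof
  define f where "f n p = ((\<lambda>g t. vector_derivative g (at t)) ^^ p) (\<lambda>t. F t $$ (nat n, j))" for n p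
  \<comment> \<open>Extension by zero keeps every row differentiable.\<close>
  define y where "y t n p = (if 0 \<le> n \<and> n \<le> int l then f n p t else 0)" for t n p
  have "(f n p has_vector_derivative f n (Suc p) t) (at t)" if "0 \<le> n" "n \<le> int l" "t \<in> S" for n p t
  proof -
    have "smooth_on S (\<lambda>t. F t $$ (nat n, j))"
      using F j that unfolding smooth_mat_fun_def by auto
    then have "f n p differentiable (at t)"
      using that unfolding smooth_on_def f_def by blast
    then show ?thesis
      by (simp add: vector_derivative_works f_def)
  qed
  then have "jet_on S y"
    unfolding jet_on_def y_def by auto
  then show "column_jet S l m j F y"
    using F unfolding column_jet_def y_def f_def smooth_mat_fun_def by auto
qed

lemma column_jet_mat_deriv:
  assumes F: "column_jet S l m j F y" and S: "open S" and j: "j < m"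
  shows "column_jet S l m j (mat_deriv F) (\<lambda>t n p. y t n (Suc p))"
proof -
  have "mat_deriv F t $$ (i, j) = y t (int i) 1" if "t \<in> S" "i \<le> l" for t i
  proof -
    have "((\<lambda>s. y s (int i) 0) has_vector_derivative y t (int i) 1) (at t)"
      using F that unfolding column_jet_def jet_on_def by auto
    then have "((\<lambda>s. F s $$ (i, j)) has_vector_derivative y t (int i) 1) (at t)"
      by (rule has_vector_derivative_transform_within_open[OF _ S])
        (use F that in \<open>auto simp: column_jet_def\<close>)
    then show ?thesis
      using F that j unfolding column_jet_def mat_deriv_def
      by (auto simp: vector_derivative_at)
  qed
  then show ?thesis
    using F unfolding column_jet_def jet_on_def
    by (auto simp: mat_deriv_def)
qed

section \<open>Tridiagonal coefficient matrices\<close>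

text \<open>The vanishing of the two corner coefficients \<open>lo 0\<close> and \<open>up l\<close> lets \<open>banded_mult_row\<close> hold in the first and
  last row in the same form as elsewhere, for arbitrary values of \<open>z\<close> outside of \<open>0, \<dots>, l\<close>.\<close>

definition banded :: "nat \<Rightarrow> real mat \<Rightarrow> (nat \<Rightarrow> real) \<Rightarrow> (nat \<Rightarrow> real) \<Rightarrow> (nat \<Rightarrow> real) \<Rightarrow> bool" where
  "banded l A lo di up \<longleftrightarrow> A \<in> carrier_mat (l + 1) (l + 1) \<and> lo 0 = 0 \<and> up l = 0 \<and>
     (\<forall>i\<le>l. \<forall>c\<le>l. A $$ (i, c) = (if i = Suc c then lo i else 0) + (if c = i then di i else 0)
        + (if c = Suc i then up i else 0))"

lemma banded_mult_row:
  assumes A: "banded l A lo di up" and G: "G \<in> carrier_mat (l + 1) m" and j: "j < m" and i: "i \<le> l"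
    and z: "\<And>c. c \<le> l \<Longrightarrow> G $$ (c, j) = z (int c)"
  shows "(cmat A * G) $$ (i, j) = of_real (lo i) * z (int i - 1) + of_real (di i) * z (int i)
    + of_real (up i) * z (int i + 1)"
proof -
  have "(cmat A * G) $$ (i, j) = (\<Sum>c = 0..<l+1. of_real (A $$ (i, c)) * G $$ (c, j))"
    using A G i j by (auto simp: banded_def scalar_prod_def)
  also have "\<dots> = (\<Sum>c = 0..<l+1. (if i = Suc c then of_real (lo i) * z (int i - 1) else 0)
      + (if c = i then of_real (di i) * z (int i) else 0)
      + (if c = Suc i then of_real (up i) * z (int i + 1) else 0))"
    using A i z by (intro sum.cong refl) (auto simp: banded_def algebra_simps)
  also have "\<dots> = (if 0 < i then of_real (lo i) * z (int i - 1) else 0) + of_real (di i) * z (int i)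
      + (if i < l then of_real (up i) * z (int i + 1) else 0)"
    using i by (cases i) (auto simp: sum.distrib)
  also have "\<dots> = of_real (lo i) * z (int i - 1) + of_real (di i) * z (int i)
      + of_real (up i) * z (int i + 1)"
    using A i by (cases "i = l"; cases "i = 0") (auto simp: banded_def)
  finally show ?thesis .
qed

lemma banded_add:
  "banded l A lo di up \<Longrightarrow> banded l A' lo' di' up' \<Longrightarrow>
   banded l (A + A') (\<lambda>i. lo i + lo' i) (\<lambda>i. di i + di' i) (\<lambda>i. up i + up' i)"
  unfolding banded_def by auto

lemma banded_smult:
  "banded l A lo di up \<Longrightarrow>
   banded l (c \<cdot>\<^sub>m A) (\<lambda>i. c * lo i) (\<lambda>i. c * di i) (\<lambda>i. c * up i)"
  unfolding banded_def by auto

lemma banded_diff: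
  "banded l A lo di up \<Longrightarrow> banded l A' lo' di' up' \<Longrightarrow>
   banded l (A - A') (\<lambda>i. lo i - lo' i) (\<lambda>i. di i - di' i) (\<lambda>i. up i - up' i)"
  unfolding banded_def by auto

lemma banded_uminus:
  "banded l A lo di up \<Longrightarrow> banded l (- A) (\<lambda>i. - lo i) (\<lambda>i. - di i) (\<lambda>i. - up i)"
  unfolding banded_def by auto

lemma banded_one: "banded l (1\<^sub>m (l + 1)) (\<lambda>i. 0) (\<lambda>i. 1) (\<lambda>i. 0)"
  unfolding banded_def by auto

lemma sum_Eunit:
  assumes "finite I"
  shows "(\<Sum>i\<in>I. f i * Eunit i (g i) r c) = (if r \<in> I \<and> c = g r then f r else 0)"
proof -
  have "(\<Sum>i\<in>I. f i * Eunit i (g i) r c) = (\<Sum>i\<in>I. if i = r then (if c = g r then f r else 0) else 0)"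
    by (rule sum.cong) (auto simp: Eunit_def)
  then show ?thesis
    using assms by simp
qed

lemma banded_C: "banded l (C_mat \<beta> l) real (\<lambda>i. \<beta> + 1 + 2 * real i) (\<lambda>i. 0)"
  unfolding banded_def C_mat_def by (auto simp: sum_Eunit)

lemma banded_U: "banded l (U_mat \<alpha> \<beta> l) (\<lambda>i. 0) (\<lambda>i. \<alpha> + \<beta> + real l + real i + 2) (\<lambda>i. 0)"
  unfolding banded_def U_mat_def by (auto simp: sum_Eunit)

lemma banded_V: "banded l (V_mat \<alpha> \<beta> k l) (\<lambda>i. 0) (\<lambda>i. real i * (\<alpha> + \<beta> - k + 1 + real i))
    (\<lambda>i. - ((real l - real i) * (\<beta> - k + 1 + real i)))"
  unfolding banded_def V_mat_def by (auto simp: sum_Eunit)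

lemma banded_Q0: "banded l (Q0_mat l) (\<lambda>i. 3 * real i) (\<lambda>i. 0) (\<lambda>i. 0)"
  unfolding banded_def Q0_mat_def by (auto simp: sum_Eunit)

lemma banded_Q1: "banded l (Q1_mat \<alpha> l) (\<lambda>i. 0) (\<lambda>i. \<alpha> - real l + 3 * real i) (\<lambda>i. 0)"
  unfolding banded_def Q1_mat_def by (auto simp: sum_Eunit)

lemma banded_P0: "banded l (P0_mat \<alpha> \<beta> k l)
    (\<lambda>i. - (real i * (3 * real i + 3 * \<beta> - 3 * k + 3 + real l + 2 * \<alpha>)))
    (\<lambda>i. (\<alpha> + 2 * real l) * (\<beta> + 1 + 2 * real i) - 3 * k * (real l - real i)
       - 3 * real i * (\<beta> - k + real i)) (\<lambda>i. 0)"
  unfolding banded_def P0_mat_def by (auto simp: sum_Eunit)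

lemma banded_P1: "banded l (P1_mat \<alpha> \<beta> k l) (\<lambda>i. 0)
    (\<lambda>i. - ((\<alpha> - real l + 3 * real i) * (\<alpha> + \<beta> + real l + real i + 2)))
    (\<lambda>i. 3 * (\<beta> - k + 1 + real i) * (real l - real i))"
  unfolding banded_def P1_mat_def by (auto simp: sum_Eunit)

section \<open>The operators in terms of jets\<close>

lemma diff_op2_row:
  assumes F: "column_jet S l m j F y" and S: "open S" and j: "j < m" and t: "t \<in> S" and i: "i \<le> l"
    and A2: "banded l (A2 t) lo2 di2 up2"
    and A1: "banded l (A1 t) lo1 di1 up1"
    and A0: "banded l (A0 t) lo0 di0 up0"
  shows "diff_op2 A2 A1 A0 F t $$ (i, j) =
      (of_real (lo2 i) * y t (int i - 1) 2 + of_real (di2 i) * y t (int i) 2 + of_real (up2 i) * y t (int i + 1) 2)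
    + (of_real (lo1 i) * y t (int i - 1) 1 + of_real (di1 i) * y t (int i) 1 + of_real (up1 i) * y t (int i + 1) 1)
    + (of_real (lo0 i) * y t (int i - 1) 0 + of_real (di0 i) * y t (int i) 0 + of_real (up0 i) * y t (int i + 1) 0)"
proof -
  have F1: "column_jet S l m j (mat_deriv F) (\<lambda>t n p. y t n (Suc p))"
    using column_jet_mat_deriv[OF F S j] .
  have F2: "column_jet S l m j (mat_deriv (mat_deriv F)) (\<lambda>t n p. y t n (Suc (Suc p)))"
    using column_jet_mat_deriv[OF F1 S j] .
  have carr: "F t \<in> carrier_mat (l + 1) m" "mat_deriv F t \<in> carrier_mat (l + 1) m"
      "mat_deriv (mat_deriv F) t \<in> carrier_mat (l + 1) m"
    using F F1 F2 t by (auto simp: column_jet_def)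
  have "A0 t \<in> carrier_mat (l + 1) (l + 1)" "A1 t \<in> carrier_mat (l + 1) (l + 1)"
    using A0 A1 by (auto simp: banded_def)
  then have "diff_op2 A2 A1 A0 F t $$ (i, j) = (cmat (A2 t) * mat_deriv (mat_deriv F) t) $$ (i, j)
      + (cmat (A1 t) * mat_deriv F t) $$ (i, j) + (cmat (A0 t) * F t) $$ (i, j)"
    using carr i j by (auto simp: diff_op2_def)
  moreover have "(cmat (A2 t) * mat_deriv (mat_deriv F) t) $$ (i, j) =
      of_real (lo2 i) * y t (int i - 1) 2 + of_real (di2 i) * y t (int i) 2 + of_real (up2 i) * y t (int i + 1) 2"
    by (rule banded_mult_row[OF A2 carr(3) j i]) (use F2 t in \<open>auto simp: column_jet_def numeral_2_eq_2\<close>)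
  moreover have "(cmat (A1 t) * mat_deriv F t) $$ (i, j) =
      of_real (lo1 i) * y t (int i - 1) 1 + of_real (di1 i) * y t (int i) 1 + of_real (up1 i) * y t (int i + 1) 1"
    by (rule banded_mult_row[OF A1 carr(2) j i]) (use F1 t in \<open>auto simp: column_jet_def\<close>)
  moreover have "(cmat (A0 t) * F t) $$ (i, j) =
      of_real (lo0 i) * y t (int i - 1) 0 + of_real (di0 i) * y t (int i) 0 + of_real (up0 i) * y t (int i + 1) 0"
    by (rule banded_mult_row[OF A0 carr(1) j i]) (use F t in \<open>auto simp: column_jet_def\<close>)
  ultimately show ?thesis by simp
qed

lemma diff_op2_carrier:
  assumes "F t \<in> carrier_mat n m" "A0 t \<in> carrier_mat n n"
  shows "diff_op2 A2 A1 A0 F t \<in> carrier_mat n m"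
  using assms by (auto simp: diff_op2_def)

lemma column_jet_D_op:
  assumes F: "column_jet S l m j F y" and S: "open S" and j: "j < m"
  shows "column_jet S l m j (D_op \<alpha> \<beta> k l F)
    (\<lambda>t. D_jet (of_real \<alpha>) (of_real \<beta>) (of_real k) (of_nat l) (of_real t) (y t))"
  unfolding column_jet_def
proof (intro conjI ballI allI impI)
  show "jet_on S (\<lambda>t. D_jet (of_real \<alpha>) (of_real \<beta>) (of_real k) (of_nat l) (of_real t) (y t))"
    using F by (intro jet_on_D_jet) (simp add: column_jet_def)
next
  fix t assume t: "t \<in> S"
  show "D_op \<alpha> \<beta> k l F t \<in> carrier_mat (l + 1) m"
    unfolding D_op_def
    by (rule diff_op2_carrier) (use F t in \<open>auto simp: column_jet_def V_mat_def\<close>)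
  fix i assume i: "i \<le> l"
  show "D_op \<alpha> \<beta> k l F t $$ (i, j)
      = D_jet (of_real \<alpha>) (of_real \<beta>) (of_real k) (of_nat l) (of_real t) (y t) (int i) 0"
    unfolding D_op_def
      diff_op2_row[where ?A2.0 = "\<lambda>u. (u * (1 - u)) \<cdot>\<^sub>m 1\<^sub>m (l + 1)", OF F S j t i
        banded_smult[OF banded_one]
        banded_diff[OF banded_C banded_smult[OF banded_U]]
        banded_uminus[OF banded_V]]
    by (simp add: D_jet_def numeral_2_eq_2 ring_distribs)
qed

text \<open>At \<open>p = 0\<close> this contains the decomposition \<open>E = (\<alpha> + 2 l + 3 k) D + 3 R\<close>, as an identity between the
  coefficients in each row.\<close>

lemma column_jet_E_op:
  assumes F: "column_jet S l m j F y" and S: "open S" and j: "j < m"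
  shows "column_jet S l m j (E_op \<alpha> \<beta> k l F)
    (\<lambda>t. E_jet (of_real \<alpha>) (of_real \<beta>) (of_real k) (of_nat l) (of_real t) (y t))"
  unfolding column_jet_def
proof (intro conjI ballI allI impI)
  show "jet_on S (\<lambda>t. E_jet (of_real \<alpha>) (of_real \<beta>) (of_real k) (of_nat l) (of_real t) (y t))"
    using F by (intro jet_on_E_jet) (simp add: column_jet_def)
next
  fix t assume t: "t \<in> S"
  show "E_op \<alpha> \<beta> k l F t \<in> carrier_mat (l + 1) m"
    unfolding E_op_def
    by (rule diff_op2_carrier) (use F t in \<open>auto simp: column_jet_def V_mat_def\<close>)
  fix i assume i: "i \<le> l"
  show "E_op \<alpha> \<beta> k l F t $$ (i, j)
      = E_jet (of_real \<alpha>) (of_real \<beta>) (of_real k) (of_nat l) (of_real t) (y t) (int i) 0"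
    unfolding E_op_def
      diff_op2_row[where ?A2.0 = "\<lambda>u. (1 - u) \<cdot>\<^sub>m (Q0_mat l + u \<cdot>\<^sub>m Q1_mat \<alpha> l)", OF F S j t i
        banded_smult[OF banded_add[OF banded_Q0 banded_smult[OF banded_Q1]]]
        banded_add[OF banded_P0 banded_smult[OF banded_P1]]
        banded_uminus[OF banded_smult[OF banded_V]]]
    by (simp add: E_jet_def R_jet_def D_jet_def numeral_2_eq_2 algebra_simps)
qed

section \<open>Commutation\<close>

theorem theorem5p1:
  fixes \<alpha> \<beta> k :: real and l :: nat
  assumes "\<alpha> > -1" and "\<beta> > -1" and "0 < k" and "k < \<beta> + 1" and "l \<ge> 1"
  shows "\<forall>S m. open S \<longrightarrow> (\<forall>F \<in> smooth_mat_fun S (l + 1) m. \<forall>u \<in> S.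
           (D_op \<alpha> \<beta> k l \<circ> E_op \<alpha> \<beta> k l) F u = (E_op \<alpha> \<beta> k l \<circ> D_op \<alpha> \<beta> k l) F u)"
proof (intro allI impI ballI)
  fix S m F u
  assume S: "open S" and F: "F \<in> smooth_mat_fun S (l + 1) m" and u: "u \<in> S"
  let ?D = "D_op \<alpha> \<beta> k l" and ?E = "E_op \<alpha> \<beta> k l"
  have Fu: "F u \<in> carrier_mat (l + 1) m"
    using F u by (simp add: smooth_mat_fun_def)
  have carr: "?D G u \<in> carrier_mat (l + 1) m" "?E G u \<in> carrier_mat (l + 1) m"
    if "G u \<in> carrier_mat (l + 1) m" for G
    using that by (auto simp: D_op_def E_op_def V_mat_def intro!: diff_op2_carrier)
  have DE: "?D (?E F) u \<in> carrier_mat (l + 1) m" and ED: "?E (?D F) u \<in> carrier_mat (l + 1) m"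
    by (intro carr Fu)+
  have "?D (?E F) u = ?E (?D F) u"
  proof (rule eq_matI)
    fix i j assume "i < dim_row (?E (?D F) u)" "j < dim_col (?E (?D F) u)"
    then have i: "i \<le> l" and j: "j < m"
      using ED by auto
    obtain y where y: "column_jet S l m j F y"
      using column_jet_exists[OF F j] by blast
    have "?D (?E F) u $$ (i, j) = D_jet (of_real \<alpha>) (of_real \<beta>) (of_real k) (of_nat l) (of_real u)
        (E_jet (of_real \<alpha>) (of_real \<beta>) (of_real k) (of_nat l) (of_real u) (y u)) (int i) 0"
      using column_jet_D_op[OF column_jet_E_op[OF y S j] S j] u i by (simp add: column_jet_def)
    also have "\<dots> = E_jet (of_real \<alpha>) (of_real \<beta>) (of_real k) (of_nat l) (of_real u)
        (D_jet (of_real \<alpha>) (of_real \<beta>) (of_real k) (of_nat l) (of_real u) (y u)) (int i) 0"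
      by (rule D_jet_E_jet_commute)
    also have "\<dots> = ?E (?D F) u $$ (i, j)"
      using column_jet_E_op[OF column_jet_D_op[OF y S j] S j] u i by (simp add: column_jet_def)
    finally show "?D (?E F) u $$ (i, j) = ?E (?D F) u $$ (i, j)" .
  qed (use DE ED in auto)
  then show "(?D \<circ> ?E) F u = (?E \<circ> ?D) F u"
    by simp
qed
end
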